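(* Let $\Delta_{ij}$, $(i,j)\in\Lambda_0$, and $T_{ij}$, $(i,j)\in\Lambda_n$, be the coefficients of the Dulac map and the Dulac time of the hyperbolic saddle of $X_{\hat\mu}$ from $\Sigma_1$ to $\Sigma_2$ (notation in the context). The following assertions hold. (a) If $(i,j)\in\Lambda_0$ and $\lambda_0\in D_{ij}^0$ then there exists $\ell\in\mathbb Z_{\ge0}$ such that the function $\hat\mu\mapsto(\lambda-\lambda_0)^\ell\Delta_{ij}(\hat\mu)$ extends $C^\infty$ to $\{\lambda_0\}\times W$. (b) If $(i,j)\in\Lambda_n$ and $\lambda_0\in D_{ij}^n$ then there exists $\ell\in\mathbb Z_{\ge0}$ such that the function $\hat\mu\mapsto(\lambda-\lambda_0)^\ell T_{ij}(\hat\mu)$ extends $C^\infty$ to $\{\lambda_0\}\times W$. Moreover, setting $\lambda_0=p/q$ with $\gcd(p,q)=1$, the estimates $\ell\le\frac ip+\frac jq\le i+j$ hold in both cases.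
   Context: Setting. $\mathbb N=\{1,2,\dots\}$. $W\subset\mathbb R^N$ is open, $\hat W=(0,+\infty)\times W$, $\hat\mu=(\lambda,\mu)\in\hat W$, $n=(n_1,n_2)\in\mathbb Z_{\ge0}^2$ is fixed, and $$X_{\hat\mu}=\frac{1}{x_1^{n_1}x_2^{n_2}}\big(x_1P_1(x_1,x_2;\hat\mu)\partial_{x_1}+x_2P_2(x_1,x_2;\hat\mu)\partial_{x_2}\big),$$ where $P_1,P_2\in C^\infty(\mathcal U\times\hat W)$ for an open set $\mathcal U\subset\mathbb R^2$ containing the origin, $P_1(x_1,0;\hat\mu)>0$ and $P_2(0,x_2;\hat\mu)<0$ for all $(x_1,0),(0,x_2)\in\mathcal U$, $\hat\mu\in\hat W$, and $\lambda=-P_2(0,0;\hat\mu)/P_1(0,0;\hat\mu)$. For $i=1,2$, $\sigma_i(s;\hat\mu)=(\sigma_{i1}(s;\hat\mu),\sigma_{i2}(s;\hat\mu))$, $(s,\hat\mu)\in(-\varepsilon,\varepsilon)\times\hat W$, is a $C^\infty$ parametrization of a section $\Sigma_i$ transverse to $X_{\hat\mu}$ at the axis $\{x_i=0\}$, with $\sigma_1(0;\hat\mu)\in\{(0,x_2):x_2>0\}$ and $\sigma_2(0;\hat\mu)\in\{(x_1,0):x_1>0\}$, parametrized so that $s>0$ corresponds to the first quadrant, i.e. $\partial_s\sigma_{11}(0;\hat\mu)>0$ and $\partial_s\sigma_{22}(0;\hat\mu)>0$. The set $\mathcal U$ contains the corner $\{(x_1,0):x_1\in[0,\sigma_{21}(0)]\}\cup\{(0,x_2):x_2\in[0,\sigma_{12}(0)]\}$.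 For small $s>0$, the Dulac map $D(s;\hat\mu)$ and Dulac time $T(s;\hat\mu)$ are defined by $\varphi(T(s),\sigma_1(s))=\sigma_2(D(s))$, where $\varphi(t,p;\hat\mu)$ is the solution of $X_{\hat\mu}$ with $\varphi(0,p)=p$ (passage from $\Sigma_1$ to $\Sigma_2$ near the corner). Index sets. For $k=(k_1,k_2)\in\mathbb Z_{\ge0}^2$: $\Lambda_k=(\mathbb Z_{\ge k_1}\times\{0\})\cup(\mathbb Z_{\ge0}\times\mathbb Z_{\ge k_2})$; $D_{ij}^k=\{\lambda>0:\exists(i',j')\in\Lambda_k\setminus\{(i,j)\},\ i+\lambda j=i'+\lambda j'\}$; $\mathcal B_{\lambda,L}^k=\{(i,j)\in\Lambda_k:i+\lambda j\le L\}$; $D_L^k=\{\lambda>0:\exists(i,j)\in\mathcal B^k_{\lambda,L},\ \lambda\in D_{ij}^k\}$; and for $\lambda=p/q\in\mathbb Q_{>0}$ with $\gcd(p,q)=1$ and $(i,j)\in\Lambda_k$, $\mathcal A_{ij\lambda}^k=\emptyset$ if $(i+rp,j-rq)\in\Lambda_k$ for some $r\in\mathbb N$, and $\mathcal A_{ij\lambda}^k=\{r\in\mathbb Z_{\ge0}:(i-rp,j+rq)\in\Lambda_k\}$ otherwise. A superscript or subscript $0$ stands for $k=(0,0)$; $n$ stands for $k=n$. The sets $D_{ij}^k$, $D_L^k$ are discrete subsets of $\mathbb Q_{>0}$. Compensator: $\omega(s;\alpha)=\frac{s^{-\alpha}-1}{\alpha}$ if $\alpha\ne0$, $\omega(s;0)=-\log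 s$, $s>0$. Flat remainders. $\psi(s;\hat\mu)$, smooth for $s>0$ small, belongs to $\mathcal F_L^\infty(\hat\mu_0)$ if for every multi-index $\nu=(\nu_0,\dots,\nu_{N+1})$ there are a neighbourhood $V$ of $\hat\mu_0$ and $C,s_0>0$ with $|\partial_s^{\nu_0}\partial_{\hat\mu}^{(\nu_1,\dots,\nu_{N+1})}\psi(s;\hat\mu)|\le Cs^{L-\nu_0}$ for $s\in(0,s_0)$, $\hat\mu\in V$; $\mathcal F_L^\infty(A)=\bigcap_{\hat\mu_0\in A}\mathcal F_L^\infty(\hat\mu_0)$. Coefficients (known result, taken as given). Let $T_0(\hat\mu)=0$ if $n\ne(0,0)$ and $T_0(\hat\mu)=-1/P_1(0,0;\hat\mu)$ if $n=(0,0)$. There exist $\Delta_{ij}\in C^\infty(((0,+\infty)\setminus D_{ij}^0)\times W)$, $(i,j)\in\Lambda_0$, and $T_{ij}\in C^\infty(((0,+\infty)\setminus D_{ij}^n)\times W)$, $(i,j)\in\Lambda_n$, such that for all $L>0$ and $\lambda_0>0$: (a1) if $\lambda_0\notin D^0_{L-\lambda_0}$ then $D(s;\hat\mu)=s^\lambda\sum_{(i,j)\in\mathcal B^0_{\lambda_0,L-\lambda_0}}\Delta_{ij}(\hat\mu)s^{i+\lambda j}+\mathcal F_L^\infty(\{\lambda_0\}\times W)$; (a2) if $\lambda_0=p/q\in D^0_{L-\lambda_0}$, $\gcd(p,q)=1$, then there is a neighbourhood $\hat U$ of $\{\lambda_0\}\times W$ such that $D(s;\hat\mu)=s^\lambda\sum_{(i,j)\in\mathcal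 B^0_{\lambda_0,L-\lambda_0}}\boldsymbol\Delta_{ij}^{\lambda_0}(\omega(s;\alpha);\hat\mu)s^{i+\lambda j}+\mathcal F_L^\infty(\{\lambda_0\}\times W)$, with $\alpha=p-\lambda q$, $\boldsymbol\Delta_{ij}^{\lambda_0}(w;\hat\mu)\in C^\infty(\hat U)[w]$ and $\boldsymbol\Delta_{ij}^{\lambda_0}(w;\hat\mu)=\sum_{r\in\mathcal A^0_{ij\lambda_0}}\Delta_{i-rp,j+rq}(\hat\mu)(1+\alpha w)^r$ for $\lambda\ne\lambda_0$; (b1) if $\lambda_0\notin D^n_L$ then $T(s;\hat\mu)=T_0(\hat\mu)\log s+\sum_{(i,j)\in\mathcal B^n_{\lambda_0,L}}T_{ij}(\hat\mu)s^{i+\lambda j}+\mathcal F_L^\infty(\{\lambda_0\}\times W)$; (b2) if $\lambda_0=p/q\in D^n_L$, $\gcd(p,q)=1$, then there is a neighbourhood $\hat U$ of $\{\lambda_0\}\times W$ such that $T(s;\hat\mu)=T_0(\hat\mu)\log s+\sum_{(i,j)\in\mathcal B^n_{\lambda_0,L}}\boldsymbol T_{ij}^{\lambda_0}(\omega(s;\alpha);\hat\mu)s^{i+\lambda j}+\mathcal F_L^\infty(\{\lambda_0\}\times W)$, with $\alpha=p-\lambda q$, $\boldsymbol T_{ij}^{\lambda_0}(w;\hat\mu)\in C^\infty(\hat U)[w]$ and $\boldsymbol T_{ij}^{\lambda_0}(w;\hat\mu)=\sum_{r\in\mathcal A^n_{ij\lambda_0}}T_{i-rp,j+rq}(\hat\mu)(1+\alpha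 w)^r$ for $\lambda\ne\lambda_0$. "Extends $C^\infty$ to $\{\lambda_0\}\times W$" means that it extends to a $C^\infty$ function on a neighbourhood of $\{\lambda_0\}\times W$. *)

theory Defs
  imports "HOL-Analysis.Analysis"
begin

section \<open>Smooth functions on open sets\<close>

definition dir_deriv :: "'a::euclidean_space \<Rightarrow> ('a \<Rightarrow> 'b::real_normed_vector) \<Rightarrow> 'a \<Rightarrow> 'b" where
  "dir_deriv b f = (\<lambda>x. frechet_derivative f (at x) b)"

text \<open>Only meant for open \<open>S\<close>: the derivatives are taken in the full space.\<close>

primrec Ck_on :: "nat \<Rightarrow> 'a::euclidean_space set \<Rightarrow> ('a \<Rightarrow> 'b::real_normed_vector) \<Rightarrow> bool" where
  "Ck_on 0 S f \<longleftrightarrow> continuous_on S f"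
| "Ck_on (Suc k) S f \<longleftrightarrow>
     (\<forall>x\<in>S. f differentiable (at x)) \<and> (\<forall>b\<in>Basis. Ck_on k S (dir_deriv b f))"

definition smooth_on :: "'a::euclidean_space set \<Rightarrow> ('a \<Rightarrow> 'b::real_normed_vector) \<Rightarrow> bool" where
  "smooth_on S f \<longleftrightarrow> (\<forall>k. Ck_on k S f)"

text \<open>A family \<open>g w m\<close>, polynomial in \<open>w\<close> with coefficients smooth in \<open>m \<in> S\<close>.\<close>

definition smooth_poly_on :: "'a::euclidean_space set \<Rightarrow> (real \<Rightarrow> 'a \<Rightarrow> real) \<Rightarrow> bool" where
  "smooth_poly_on S g \<longleftrightarrow>
     (\<exists>d c. (\<forall>k\<le>d. smooth_on S (c k)) \<and>
            (\<forall>w. \<forall>m\<in>S. g w m = (\<Sum>k\<le>d::nat. c k m * w ^ k)))"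

section \<open>Parameters, the family of vector fields, sections\<close>

text \<open>A parameter is a pair \<open>(\<lambda>, \<mu>)\<close>, where \<open>\<lambda>\<close> is the hyperbolicity ratio of the saddle.\<close>

type_synonym 'n param = "real \<times> (real^'n)"

definition hat :: "(real^'n) set \<Rightarrow> 'n param set" where
  "hat W = {0<..} \<times> W"

text \<open>The saddle without the monomial factor \<open>1 / (x\<^sub>1^n\<^sub>1 x\<^sub>2^n\<^sub>2)\<close>. Transversality at a point of
  an axis, where the full field may have a pole, refers to this field.\<close>

definition regular_field ::
  "(((real \<times> real) \<times> 'n param) \<Rightarrow> real) \<Rightarrow> (((real \<times> real) \<times> 'n param) \<Rightarrow> real) \<Rightarrow>
    'n param \<Rightarrow> real \<times> real \<Rightarrow> real \<times> real" where
  "regular_field P1 P2 m x = (fst x * P1 (x, m), snd x * P2 (x, m))"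

definition saddle_field ::
  "nat \<times> nat \<Rightarrow> (((real \<times> real) \<times> 'n param) \<Rightarrow> real) \<Rightarrow> (((real \<times> real) \<times> 'n param) \<Rightarrow> real) \<Rightarrow>
    'n param \<Rightarrow> real \<times> real \<Rightarrow> real \<times> real" where
  "saddle_field n P1 P2 m x =
     (1 / (fst x ^ fst n * snd x ^ snd n)) *\<^sub>R regular_field P1 P2 m x"

definition saddle_family ::
  "(real^'n) set \<Rightarrow> (real \<times> real) set \<Rightarrow>
    (((real \<times> real) \<times> 'n param) \<Rightarrow> real) \<Rightarrow> (((real \<times> real) \<times> 'n param) \<Rightarrow> real) \<Rightarrow> bool" where
  "saddle_family W U P1 P2 \<longleftrightarrow>
     open W \<and> open U \<and> (0, 0) \<in> U \<and>
     smooth_on (U \<times> hat W) P1 \<and> smooth_on (U \<times> hat W) P2 \<and>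
     (\<forall>m\<in>hat W. \<forall>x1. (x1, 0) \<in> U \<longrightarrow> P1 ((x1, 0), m) > 0) \<and>
     (\<forall>m\<in>hat W. \<forall>x2. (0, x2) \<in> U \<longrightarrow> P2 ((0, x2), m) < 0) \<and>
     (\<forall>m\<in>hat W. fst m = - P2 ((0, 0), m) / P1 ((0, 0), m))"

definition corner ::
  "(real \<times> 'n param \<Rightarrow> real \<times> real) \<Rightarrow> (real \<times> 'n param \<Rightarrow> real \<times> real) \<Rightarrow>
    'n param \<Rightarrow> (real \<times> real) set" where
  "corner \<sigma>1 \<sigma>2 m = {0..fst (\<sigma>2 (0, m))} \<times> {0} \<union> {0} \<times> {0..snd (\<sigma>1 (0, m))}"

definition section_velocity :: "(real \<times> 'n param \<Rightarrow> real \<times> real) \<Rightarrow> 'n param \<Rightarrow> real \<times> real" where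
  "section_velocity \<sigma> m = vector_derivative (\<lambda>s. \<sigma> (s, m)) (at 0)"

definition transverse_sections ::
  "(real^'n) set \<Rightarrow> (real \<times> real) set \<Rightarrow>
    (((real \<times> real) \<times> 'n param) \<Rightarrow> real) \<Rightarrow> (((real \<times> real) \<times> 'n param) \<Rightarrow> real) \<Rightarrow>
    real \<Rightarrow> (real \<times> 'n param \<Rightarrow> real \<times> real) \<Rightarrow> (real \<times> 'n param \<Rightarrow> real \<times> real) \<Rightarrow> bool" where
  "transverse_sections W U P1 P2 \<epsilon> \<sigma>1 \<sigma>2 \<longleftrightarrow>
     \<epsilon> > 0 \<and>
     smooth_on ({-\<epsilon><..<\<epsilon>} \<times> hat W) \<sigma>1 \<and> smooth_on ({-\<epsilon><..<\<epsilon>} \<times> hat W) \<sigma>2 \<and>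
     (\<forall>m\<in>hat W.
        corner \<sigma>1 \<sigma>2 m \<subseteq> U \<and>
        fst (\<sigma>1 (0, m)) = 0 \<and> snd (\<sigma>1 (0, m)) > 0 \<and>
        snd (\<sigma>2 (0, m)) = 0 \<and> fst (\<sigma>2 (0, m)) > 0 \<and>
        \<not> collinear {0, section_velocity \<sigma>1 m, regular_field P1 P2 m (\<sigma>1 (0, m))} \<and>
        \<not> collinear {0, section_velocity \<sigma>2 m, regular_field P1 P2 m (\<sigma>2 (0, m))} \<and>
        fst (section_velocity \<sigma>1 m) > 0 \<and> snd (section_velocity \<sigma>2 m) > 0)"

section \<open>Dulac map and Dulac time\<close>

definition integral_curve_on ::
  "real \<Rightarrow> (real \<times> real \<Rightarrow> real \<times> real) \<Rightarrow> (real \<Rightarrow> real \<times> real) \<Rightarrow> bool" where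
  "integral_curve_on T X \<gamma> \<longleftrightarrow>
     (\<forall>t\<in>{0..T}. (\<gamma> has_vector_derivative X (\<gamma> t)) (at t within {0..T}))"

text \<open>\<open>D\<close> and \<open>T\<close> are germs at \<open>s = 0\<^sup>+\<close>, locally uniformly in the parameter. The curve
  \<open>\<gamma>\<close> is the trajectory \<open>t \<mapsto> \<phi>(t, \<sigma>\<^sub>1(s))\<close>. The passage takes place near the corner: for \<open>s\<close>
  small the trajectory stays in any prescribed neighbourhood \<open>N\<close> of the corner, and its end point
  on the second section is close to the axis. This singles out the first passage, as opposed to
  later returns of the same trajectory to the second section.\<close>

definition dulac_map_time ::
  "nat \<times> nat \<Rightarrow> (real^'n) set \<Rightarrow> (real \<times> real) set \<Rightarrow>
    (((real \<times> real) \<times> 'n param) \<Rightarrow> real) \<Rightarrow> (((real \<times> real) \<times> 'n param) \<Rightarrow> real) \<Rightarrow>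
    (real \<times> 'n param \<Rightarrow> real \<times> real) \<Rightarrow> (real \<times> 'n param \<Rightarrow> real \<times> real) \<Rightarrow>
    (real \<times> 'n param \<Rightarrow> real) \<Rightarrow> (real \<times> 'n param \<Rightarrow> real) \<Rightarrow> bool" where
  "dulac_map_time n W U P1 P2 \<sigma>1 \<sigma>2 D T \<longleftrightarrow>
     (\<forall>m0\<in>hat W. \<forall>N. \<forall>\<eta>>0. open N \<and> corner \<sigma>1 \<sigma>2 m0 \<subseteq> N \<longrightarrow>
        (\<exists>V s0. open V \<and> m0 \<in> V \<and> V \<subseteq> hat W \<and> s0 > 0 \<and>
          (\<forall>m\<in>V. \<forall>s\<in>{0<..<s0}.
             0 < D (s, m) \<and> D (s, m) < \<eta> \<and> T (s, m) > 0 \<and>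
             (\<exists>\<gamma>. integral_curve_on (T (s, m)) (saddle_field n P1 P2 m) \<gamma> \<and>
                  \<gamma> ` {0..T (s, m)} \<subseteq> N \<inter> U \<inter> {0<..} \<times> {0<..} \<and>
                  \<gamma> 0 = \<sigma>1 (s, m) \<and> \<gamma> (T (s, m)) = \<sigma>2 (D (s, m), m)))))"

section \<open>Index sets\<close>

definition Lam :: "nat \<times> nat \<Rightarrow> (int \<times> int) set" where
  "Lam k = {int (fst k)..} \<times> {0} \<union> {0..} \<times> {int (snd k)..}"

definition D_res :: "nat \<times> nat \<Rightarrow> int \<Rightarrow> int \<Rightarrow> real set" where
  "D_res k i j =
     {l. l > 0 \<and> (\<exists>(i', j') \<in> Lam k - {(i, j)}.
        real_of_int i + l * real_of_int j = real_of_int i' + l * real_of_int j')}"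

definition B_set :: "nat \<times> nat \<Rightarrow> real \<Rightarrow> real \<Rightarrow> (int \<times> int) set" where
  "B_set k l L = {(i, j) \<in> Lam k. real_of_int i + l * real_of_int j \<le> L}"

definition D_cut :: "nat \<times> nat \<Rightarrow> real \<Rightarrow> real set" where
  "D_cut k L = {l. l > 0 \<and> (\<exists>(i, j) \<in> B_set k l L. l \<in> D_res k i j)}"

text \<open>The set \<open>\<A>\<close> for \<open>\<lambda> = p / q\<close>, with \<open>p, q\<close> positive and coprime.\<close>

definition A_set :: "nat \<times> nat \<Rightarrow> nat \<Rightarrow> nat \<Rightarrow> int \<Rightarrow> int \<Rightarrow> nat set" where
  "A_set k p q i j =
     (if \<exists>r::nat. r \<ge> 1 \<and> (i + int r * int p, j - int r * int q) \<in> Lam k then {}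
      else {r. (i - int r * int p, j + int r * int q) \<in> Lam k})"

section \<open>Compensator and flat remainders\<close>

definition compensator :: "real \<Rightarrow> real \<Rightarrow> real" where
  "compensator s \<alpha> = (if \<alpha> = 0 then - ln s else (s powr (-\<alpha>) - 1) / \<alpha>)"

text \<open>A multi-index is given by the order \<open>\<nu>0\<close> in \<open>s\<close> and a list \<open>vs\<close> of coordinate
  directions of the parameter space, one entry for each derivative taken.\<close>

definition iter_partial ::
  "nat \<Rightarrow> ('n::finite) param list \<Rightarrow> (real \<times> 'n param \<Rightarrow> real) \<Rightarrow> real \<times> 'n param \<Rightarrow> real" where
  "iter_partial \<nu>0 vs \<psi> = (dir_deriv (1, 0) ^^ \<nu>0) (foldr (\<lambda>v. dir_deriv (0, v)) vs \<psi>)"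

definition flat_at :: "real \<Rightarrow> ('n::finite) param \<Rightarrow> (real \<times> 'n param \<Rightarrow> real) \<Rightarrow> bool" where
  "flat_at L m0 \<psi> \<longleftrightarrow>
     (\<exists>V s0. open V \<and> m0 \<in> V \<and> s0 > 0 \<and> smooth_on ({0<..<s0} \<times> V) \<psi>) \<and>
     (\<forall>\<nu>0 vs. set vs \<subseteq> Basis \<longrightarrow>
        (\<exists>V C s0. open V \<and> m0 \<in> V \<and> C > 0 \<and> s0 > 0 \<and>
           (\<forall>s\<in>{0<..<s0}. \<forall>m\<in>V.
              \<bar>iter_partial \<nu>0 vs \<psi> (s, m)\<bar> \<le> C * s powr (L - real \<nu>0))))"

definition flat_on :: "real \<Rightarrow> ('n::finite) param set \<Rightarrow> (real \<times> 'n param \<Rightarrow> real) \<Rightarrow> bool" where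
  "flat_on L A \<psi> \<longleftrightarrow> (\<forall>m0\<in>A. flat_at L m0 \<psi>)"

section \<open>Coefficients of the asymptotic expansions\<close>

text \<open>The domain \<open>((0, \<infinity>) \<setminus> D\<^sub>i\<^sub>j) \<times> W\<close> of the coefficient of index \<open>(i, j)\<close>. Coefficients
  are total functions whose values outside this set carry no meaning.\<close>

definition coeff_dom :: "(real^'n) set \<Rightarrow> nat \<times> nat \<Rightarrow> int \<Rightarrow> int \<Rightarrow> 'n param set" where
  "coeff_dom W k i j = ({0<..} - D_res k i j) \<times> W"

definition dulac_map_coeffs ::
  "(real^'n) set \<Rightarrow> (real \<times> 'n param \<Rightarrow> real) \<Rightarrow> (int \<Rightarrow> int \<Rightarrow> 'n param \<Rightarrow> real) \<Rightarrow> bool" where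
  "dulac_map_coeffs W D \<Delta> \<longleftrightarrow>
     (\<forall>(i, j) \<in> Lam (0, 0). smooth_on (coeff_dom W (0, 0) i j) (\<Delta> i j)) \<and>
     (\<forall>L>0. \<forall>l0>0.
        (l0 \<notin> D_cut (0, 0) (L - l0) \<longrightarrow>
          flat_on L ({l0} \<times> W)
            (\<lambda>(s, m). D (s, m) - s powr fst m *
               (\<Sum>(i, j) \<in> B_set (0, 0) l0 (L - l0).
                  \<Delta> i j m * s powr (real_of_int i + fst m * real_of_int j)))) \<and>
        (\<forall>p q. 0 < p \<and> 0 < q \<and> coprime p q \<and> l0 = real p / real q \<and> l0 \<in> D_cut (0, 0) (L - l0) \<longrightarrow>
          (\<exists>U' B\<Delta>. open U' \<and> {l0} \<times> W \<subseteq> U' \<and> U' \<subseteq> hat W \<and>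
             (\<forall>(i, j) \<in> B_set (0, 0) l0 (L - l0).
                smooth_poly_on U' (B\<Delta> i j) \<and>
                (\<forall>w. \<forall>m\<in>U'. fst m \<noteq> l0 \<longrightarrow>
                   B\<Delta> i j w m =
                     (\<Sum>r \<in> A_set (0, 0) p q i j.
                        \<Delta> (i - int r * int p) (j + int r * int q) m *
                        (1 + (real p - fst m * real q) * w) ^ r))) \<and>
             flat_on L ({l0} \<times> W)
               (\<lambda>(s, m). D (s, m) - s powr fst m *
                  (\<Sum>(i, j) \<in> B_set (0, 0) l0 (L - l0).
                     B\<Delta> i j (compensator s (real p - fst m * real q)) m *
                     s powr (real_of_int i + fst m * real_of_int j))))))"

definition T0_coeff ::
  "nat \<times> nat \<Rightarrow> (((real \<times> real) \<times> 'n param) \<Rightarrow> real) \<Rightarrow> 'n param \<Rightarrow> real" where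
  "T0_coeff n P1 m = (if n = (0, 0) then - 1 / P1 ((0, 0), m) else 0)"

definition dulac_time_coeffs ::
  "nat \<times> nat \<Rightarrow> (real^'n) set \<Rightarrow> (((real \<times> real) \<times> 'n param) \<Rightarrow> real) \<Rightarrow>
    (real \<times> 'n param \<Rightarrow> real) \<Rightarrow> (int \<Rightarrow> int \<Rightarrow> 'n param \<Rightarrow> real) \<Rightarrow> bool" where
  "dulac_time_coeffs n W P1 T Tc \<longleftrightarrow>
     (\<forall>(i, j) \<in> Lam n. smooth_on (coeff_dom W n i j) (Tc i j)) \<and>
     (\<forall>L>0. \<forall>l0>0.
        (l0 \<notin> D_cut n L \<longrightarrow>
          flat_on L ({l0} \<times> W)
            (\<lambda>(s, m). T (s, m) - (T0_coeff n P1 m * ln s +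
               (\<Sum>(i, j) \<in> B_set n l0 L.
                  Tc i j m * s powr (real_of_int i + fst m * real_of_int j))))) \<and>
        (\<forall>p q. 0 < p \<and> 0 < q \<and> coprime p q \<and> l0 = real p / real q \<and> l0 \<in> D_cut n L \<longrightarrow>
          (\<exists>U' BT. open U' \<and> {l0} \<times> W \<subseteq> U' \<and> U' \<subseteq> hat W \<and>
             (\<forall>(i, j) \<in> B_set n l0 L.
                smooth_poly_on U' (BT i j) \<and>
                (\<forall>w. \<forall>m\<in>U'. fst m \<noteq> l0 \<longrightarrow>
                   BT i j w m =
                     (\<Sum>r \<in> A_set n p q i j.
                        Tc (i - int r * int p) (j + int r * int q) m *
                        (1 + (real p - fst m * real q) * w) ^ r))) \<and>
             flat_on L ({l0} \<times> W)
               (\<lambda>(s, m). T (s, m) - (T0_coeff n P1 m * ln s +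
                  (\<Sum>(i, j) \<in> B_set n l0 L.
                     BT i j (compensator s (real p - fst m * real q)) m *
                     s powr (real_of_int i + fst m * real_of_int j)))))))"

text \<open>\<open>f\<close>, given on \<open>S\<close>, extends to a smooth function on a neighbourhood of \<open>{l0} \<times> W\<close>.\<close>

definition extends_smoothly ::
  "(real^'n) set \<Rightarrow> real \<Rightarrow> 'n param set \<Rightarrow> ('n param \<Rightarrow> real) \<Rightarrow> bool" where
  "extends_smoothly W l0 S f \<longleftrightarrow>
     (\<exists>V g. open V \<and> {l0} \<times> W \<subseteq> V \<and> smooth_on V g \<and> (\<forall>m \<in> V \<inter> S. g m = f m))"

end

theory Submission
  imports Defs "HOL-Computational_Algebra.Polynomial"
begin

text \<open>Let \<open>l0 = p / q\<close> and \<open>\<alpha> = p - q * \<lambda>\<close>. The indices with the same value of \<open>i + l0 * j\<close> lie on a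
  line of direction \<open>(p, -q)\<close>, and the coefficients \<open>a r\<close> at the points \<open>(i' - r * p, j' + r * q)\<close> of
  that line occur together in the expansion at the index \<open>(i', j')\<close> of the line with largest \<open>i'\<close>: there
  \<open>\<Sum>r. a r * (1 + \<alpha> * w) ^ r = \<Sum>k. c k * w ^ k\<close>, where the \<open>c k\<close> are smooth also at \<open>\<alpha> = 0\<close>.
  Substituting \<open>w = (v - 1) / \<alpha>\<close> expresses each \<open>a r\<close> as a combination of the \<open>c k / \<alpha> ^ k\<close> with
  \<open>k \<le> R\<close>, where \<open>R\<close> is the largest \<open>r\<close> that occurs, so \<open>\<alpha> ^ R * a r\<close> is smooth. The point
  \<open>(i' - R * p, j' + R * q)\<close> has nonnegative coordinates; this bounds \<open>R\<close>.\<close>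

section \<open>Smooth functions\<close>

text \<open>On an open set, agreement on \<open>S\<close> is agreement near each of its points, so
  derivatives of every order agree. This lets the sum and product rules, valid only at points of
  \<open>S\<close>, replace the derivatives there.\<close>

lemma Ck_on_cong:
  assumes "open S" "\<And>x. x \<in> S \<Longrightarrow> f x = g x" "Ck_on k S f"
  shows "Ck_on k S g"
  using assms(2,3)
proof (induction k arbitrary: f g)
  case 0
  then show ?case by (simp cong: continuous_on_cong)
next
  case (Suc k)
  have D: "(f has_derivative f') (at x) \<longleftrightarrow> (g has_derivative f') (at x)" if "x \<in> S" for x f'
    using that Suc.prems(1) assms(1)
    by (metis has_derivative_transform_within_open)
  \<comment> \<open>\<open>frechet_derivative\<close> is a choice among the derivatives at
    \<open>x\<close>. By \<open>D\<close> the two predicates chosen from coincide, hence so do the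
    choices.\<close>
  have "dir_deriv b f x = dir_deriv b g x" if "x \<in> S" for x b
    unfolding dir_deriv_def frechet_derivative_def using D[OF that] by simp
  moreover have "g differentiable (at x)" if "x \<in> S" for x
    using Suc.prems(2) D[OF that] that unfolding differentiable_def
    by (metis Ck_on.simps(2) differentiable_def)
  ultimately show ?case
    using Suc.IH[of "dir_deriv _ f" "dir_deriv _ g"] Suc.prems(2) by auto
qed

text \<open>The recursion does not record continuity at successor orders; differentiability supplies
  it. The product rule needs the lower order, since its terms keep one factor underived.\<close>

lemma Ck_on_Suc_imp:
  assumes "Ck_on (Suc k) S f"
  shows "Ck_on k S f"
  using assms
proof (induction k arbitrary: f)
  case 0
  then show ?case
    by (auto intro!: continuous_at_imp_continuous_on differentiable_imp_continuous_within)
next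
  case (Suc k)
  then show ?case by auto
qed

lemma Ck_on_const:
  fixes S :: "'a::euclidean_space set"
  shows "Ck_on k S (\<lambda>x. c)"
proof (induction k arbitrary: c)
  case (Suc k)
  have "dir_deriv b (\<lambda>x. c) = (\<lambda>x. 0)" for b :: 'a
    by (simp add: dir_deriv_def fun_eq_iff)
  then show ?case using Suc by simp
qed simp

lemma Ck_on_bounded_linear:
  assumes "bounded_linear f"
  shows "Ck_on k S f"
proof (cases k)
  case 0
  then show ?thesis by (simp add: assms linear_continuous_on)
next
  case (Suc k')
  have "frechet_derivative f (at x) = f" for x
    using bounded_linear_imp_has_derivative[OF assms] frechet_derivative_at by metis
  then have "dir_deriv b f = (\<lambda>x. f b)" for b
    by (simp add: dir_deriv_def fun_eq_iff)
  then show ?thesis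
    using Suc assms bounded_linear_imp_differentiable by (auto simp: Ck_on_const)
qed

lemma Ck_on_add:
  assumes "open S" "Ck_on k S f" "Ck_on k S g"
  shows "Ck_on k S (\<lambda>x. f x + g x)"
  using assms(2,3)
proof (induction k arbitrary: f g)
  case 0
  then show ?case by (simp add: continuous_on_add)
next
  case (Suc k)
  have "Ck_on k S (dir_deriv b (\<lambda>x. f x + g x))" if "b \<in> Basis" for b
  proof (rule Ck_on_cong[OF assms(1)])
    show "Ck_on k S (\<lambda>x. dir_deriv b f x + dir_deriv b g x)"
      using Suc that by simp
    fix x assume "x \<in> S"
    then have "((\<lambda>x. f x + g x) has_derivative
        (\<lambda>h. frechet_derivative f (at x) h + frechet_derivative g (at x) h)) (at x)"
      using Suc.prems by (intro has_derivative_add) (auto simp flip: frechet_derivative_works)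
    then show "dir_deriv b f x + dir_deriv b g x = dir_deriv b (\<lambda>x. f x + g x) x"
      by (simp add: dir_deriv_def flip: frechet_derivative_at)
  qed
  then show ?case using Suc.prems by auto
qed

lemma Ck_on_mult:
  fixes f g :: "'a::euclidean_space \<Rightarrow> 'b::real_normed_algebra"
  assumes "open S" "Ck_on k S f" "Ck_on k S g"
  shows "Ck_on k S (\<lambda>x. f x * g x)"
  using assms(2,3)
proof (induction k arbitrary: f g)
  case 0
  then show ?case by (simp add: continuous_on_mult)
next
  case (Suc k)
  have "Ck_on k S (dir_deriv b (\<lambda>x. f x * g x))" if "b \<in> Basis" for b
  proof (rule Ck_on_cong[OF assms(1)])
    show "Ck_on k S (\<lambda>x. f x * dir_deriv b g x + dir_deriv b f x * g x)"
      using Suc that Ck_on_Suc_imp[OF Suc.prems(1)] Ck_on_Suc_imp[OF Suc.prems(2)]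
      by (intro Ck_on_add[OF assms(1)]) auto
    fix x assume "x \<in> S"
    then have "((\<lambda>x. f x * g x) has_derivative
        (\<lambda>h. f x * frechet_derivative g (at x) h + frechet_derivative f (at x) h * g x)) (at x)"
      using Suc.prems by (intro has_derivative_mult) (auto simp flip: frechet_derivative_works)
    then show "f x * dir_deriv b g x + dir_deriv b f x * g x = dir_deriv b (\<lambda>x. f x * g x) x"
      by (simp add: dir_deriv_def flip: frechet_derivative_at)
  qed
  then show ?case using Suc.prems by auto
qed

lemma smooth_on_const: "smooth_on S (\<lambda>x. c)"
  by (simp add: smooth_on_def Ck_on_const)

lemma smooth_on_bounded_linear: "bounded_linear f \<Longrightarrow> smooth_on S f"
  by (simp add: smooth_on_def Ck_on_bounded_linear)

lemma smooth_on_add: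
  "open S \<Longrightarrow> smooth_on S f \<Longrightarrow> smooth_on S g \<Longrightarrow> smooth_on S (\<lambda>x. f x + g x)"
  by (simp add: smooth_on_def Ck_on_add)

lemma smooth_on_mult:
  fixes f g :: "'a::euclidean_space \<Rightarrow> 'b::real_normed_algebra"
  shows "open S \<Longrightarrow> smooth_on S f \<Longrightarrow> smooth_on S g \<Longrightarrow> smooth_on S (\<lambda>x. f x * g x)"
  by (simp add: smooth_on_def Ck_on_mult)

lemma smooth_on_power:
  fixes f :: "'a::euclidean_space \<Rightarrow> 'b::real_normed_algebra_1"
  assumes "open S" "smooth_on S f"
  shows "smooth_on S (\<lambda>x. f x ^ k)"
  by (induction k) (simp_all add: smooth_on_const smooth_on_mult assms)

lemma smooth_on_sum:
  assumes "open S" "\<And>a. a \<in> A \<Longrightarrow> smooth_on S (f a)"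
  shows "smooth_on S (\<lambda>x. \<Sum>a\<in>A. f a x)"
  using assms(2)
  by (induction A rule: infinite_finite_induct) (simp_all add: smooth_on_const smooth_on_add assms(1))

section \<open>The change of variable in the polynomials\<close>

text \<open>Here \<open>t\<close> will be the distance of the parameter \<lambda> to the resonance
  and \<open>\<beta>\<close> a nonzero constant. The equation assumes \<open>t\<close> nonzero, but
  its right side has only nonnegative powers of \<open>t\<close>, so it still makes sense at
  \<open>t = 0\<close>.\<close>

lemma coeff_of_affine_substitution:
  fixes a c :: "nat \<Rightarrow> real" and \<beta> t :: real
  assumes eq: "\<And>w. (\<Sum>k\<le>d. c k * w ^ k) = (\<Sum>r\<in>A. a r * (1 + \<beta> * t * w) ^ r)"
    and A: "A \<subseteq> {..R}" and r: "r \<in> A" and "\<beta> \<noteq> 0" "t \<noteq> 0"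
  shows "t ^ R * a r =
    (\<Sum>k\<in>{..d} \<inter> {..R}. c k * (t ^ (R - k) * coeff ([:- 1 / \<beta>, 1 / \<beta>:] ^ k) r))"
proof -
  have "finite A" using A finite_subset by blast
  define P where "P = (\<Sum>k\<le>d. monom (c k) k)"
  define Q where "Q = (\<Sum>r\<in>A. monom (a r) r)"
  have coeff_P: "coeff P k = (if k \<le> d then c k else 0)" for k
    by (simp add: P_def coeff_sum)
  have coeff_Q: "coeff Q r = (if r \<in> A then a r else 0)" for r
    using \<open>finite A\<close> by (simp add: Q_def coeff_sum)
  have "poly P w = poly (pcompose Q [:1, \<beta> * t:]) w" for w
    using eq[of w] by (simp add: P_def Q_def poly_sum poly_monom poly_pcompose mult_ac)
  then have P: "P = pcompose Q [:1, \<beta> * t:]"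
    by (intro poly_eq_poly_eq_iff[THEN iffD1] ext)
  \<comment> \<open>Composition with a polynomial of degree one preserves the degree, so
    \<open>P\<close> inherits the bound and \<open>c k\<close> vanishes for \<open>k > R\<close>.
    Without this, \<open>t ^ R\<close> could not clear all denominators
    \<open>t ^ k\<close>.\<close>
  have "degree Q \<le> R"
    by (rule degree_le) (use A coeff_Q in auto)
  then have "degree P \<le> R"
    using assms(4,5) by (simp add: P degree_pcompose)
  then have c0: "c k = 0" if "k \<le> d" "k > R" for k
    using coeff_P[of k] coeff_eq_0[of P k] that by simp
  \<comment> \<open>\<open>?e\<close> is (v - 1) / \<beta>, so w = \<open>?e\<close> / t solves 1 +
    \<beta> t w = v. Keeping \<open>t\<close> out of \<open>?e\<close> makes the coefficients of its
    powers constants.\<close>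
  let ?e = "[:- 1 / \<beta>, 1 / \<beta>:]"
  have "poly Q v = poly (\<Sum>k\<le>d. smult (c k / t ^ k) (?e ^ k)) v" for v
  proof -
    have "poly Q v = poly P (poly ?e v / t)"
      using assms(4,5) by (simp add: P poly_pcompose field_simps)
    also have "\<dots> = (\<Sum>k\<le>d. c k * (poly ?e v / t) ^ k)"
      by (simp add: P_def poly_sum poly_monom)
    finally show ?thesis
      by (simp add: poly_sum poly_power power_divide)
  qed
  then have "Q = (\<Sum>k\<le>d. smult (c k / t ^ k) (?e ^ k))"
    by (intro poly_eq_poly_eq_iff[THEN iffD1] ext)
  then have "a r = coeff (\<Sum>k\<le>d. smult (c k / t ^ k) (?e ^ k)) r"
    using coeff_Q[of r] r by simp
  also have "\<dots> = (\<Sum>k\<le>d. c k / t ^ k * coeff (?e ^ k) r)"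
    by (simp add: coeff_sum)
  also have "\<dots> = (\<Sum>k\<in>{..d} \<inter> {..R}. c k / t ^ k * coeff (?e ^ k) r)"
    by (rule sum.mono_neutral_right) (use c0 in auto)
  finally show ?thesis
    using assms(5) by (simp add: sum_distrib_left power_diff mult_ac)
qed

section \<open>Resonant indices\<close>

lemma Lam_nonneg: "(i, j) \<in> Lam k \<Longrightarrow> 0 \<le> i \<and> 0 \<le> j"
  by (auto simp: Lam_def)

lemma D_res_rational:
  assumes "l0 \<in> D_res k i j"
  obtains p q :: nat where "0 < p" "0 < q" "coprime p q" "l0 = real p / real q"
proof -
  from assms obtain i' j' where l0: "l0 > 0" "(i', j') \<noteq> (i, j)"
    and eq: "real_of_int i + l0 * real_of_int j = real_of_int i' + l0 * real_of_int j'"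
    by (auto simp: D_res_def)
  \<comment> \<open>If \<open>j = j'\<close>, the resonance equation would force
    \<open>i = i'\<close> as well.\<close>
  then have "j \<noteq> j'" by auto
  then have "l0 = real_of_int (i - i') / real_of_int (j' - j)"
    using eq by (simp add: field_simps)
  then have "l0 \<in> \<rat>" by simp
  then obtain p q :: nat where "q \<noteq> 0" "\<bar>l0\<bar> = real p / real q" "coprime p q"
    by (rule Rats_abs_nat_div_natE)
  then show ?thesis
    using that[of p q] l0 by (cases p) auto
qed

lemma coprime_fraction_unique:
  fixes p q p' q' :: nat
  assumes "coprime p q" "coprime p' q'" "0 < q" "0 < q'" "real p / real q = real p' / real q'"
  shows "p = p'" "q = q'"
proof -
  have "real (p * q') = real (p' * q)" using assms by (simp add: field_simps)
  then have "p * q' = p' * q" by (simp only: of_nat_eq_iff)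
  then show "p = p'" "q = q'"
    using coprime_crossproduct_nat[of p q p' q'] assms by (auto simp: mult.commute)
qed

text \<open>Climbing from \<open>(i, j)\<close> in direction \<open>(p, -q)\<close> lowers the
  second coordinate, which is nonnegative on \<open>Lam k\<close>, so there is a last step that
  lands in \<open>Lam k\<close>. Gaps before it do no harm: emptiness of \<open>A_set\<close> is
  decided by the points beyond, and descending \<open>r\<close> steps returns to
  \<open>(i, j)\<close>.\<close>

lemma top_index:
  assumes "(i, j) \<in> Lam k" "0 < q"
  obtains i' j' r where "(i', j') \<in> Lam k" "i = i' - int r * int p" "j = j' + int r * int q"
    "r \<in> A_set k p q i' j'"
proof -
  let ?P = "\<lambda>r::nat. (i + int r * int p, j - int r * int q) \<in> Lam k"
  have bound: "r \<le> nat j" if "?P r" for r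
  proof -
    have "int r \<le> int r * int q"
      using assms(2) mult_left_mono[of 1 "int q" "int r"] by simp
    also have "\<dots> \<le> j" using Lam_nonneg[OF that] by simp
    finally show ?thesis by simp
  qed
  define r where "r = (GREATEST r. ?P r)"
  have r: "?P r"
    unfolding r_def by (rule GreatestI_nat[of ?P 0 "nat j"]) (use assms bound in auto)
  have max: "r' \<le> r" if "?P r'" for r'
    unfolding r_def by (rule Greatest_le_nat[of ?P _ "nat j"]) (use that bound in auto)
  let ?i = "i + int r * int p" and ?j = "j - int r * int q"
  have "(?i + int r' * int p, ?j - int r' * int q) \<notin> Lam k" if "r' \<ge> 1" for r'
    using max[of "r + r'"] that by (auto simp: algebra_simps)
  then have "r \<in> A_set k p q ?i ?j"
    using assms(1) by (auto simp: A_set_def)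
  then show ?thesis
    using that[of ?i ?j r] r by simp
qed

lemma A_set_bound:
  assumes "r \<in> A_set k p q i j" "0 < p"
  shows "real r \<le> real_of_int i / real p"
proof -
  have "(i - int r * int p, j + int r * int q) \<in> Lam k"
    using assms(1) by (auto simp: A_set_def split: if_splits)
  then have "int r * int p \<le> i"
    using Lam_nonneg by fastforce
  then have "real_of_int (int r * int p) \<le> real_of_int i"
    by (simp only: of_int_le_iff)
  then show ?thesis
    using assms(2) by (simp add: field_simps)
qed

text \<open>Of two distinct points with nonnegative coordinates one is not the origin, and both have
  the same value. Positivity matters because the expansions are given only for
  \<open>L > 0\<close>.\<close>

lemma D_res_pos:
  assumes "(i, j) \<in> Lam k" "l0 \<in> D_res k i j"
  shows "0 < l0" "0 < real_of_int i + l0 * real_of_int j"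
proof -
  from assms(2) obtain i' j' where l0: "l0 > 0" and ne: "(i', j') \<noteq> (i, j)" "(i', j') \<in> Lam k"
    and eq: "real_of_int i + l0 * real_of_int j = real_of_int i' + l0 * real_of_int j'"
    by (auto simp: D_res_def)
  have nonneg: "0 \<le> i" "0 \<le> j" "0 \<le> i'" "0 \<le> j'"
    using Lam_nonneg assms(1) ne(2) by blast+
  have "0 < a \<or> 0 < b \<Longrightarrow> 0 < real_of_int a + l0 * real_of_int b" if "0 \<le> a" "0 \<le> b" for a b
    using that l0 by (auto intro: add_pos_nonneg add_nonneg_pos)
  moreover have "0 < i \<or> 0 < j \<or> 0 < i' \<or> 0 < j'"
    using nonneg ne(1) by auto
  ultimately show "0 < real_of_int i + l0 * real_of_int j"
    using eq nonneg by metis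
  show "0 < l0" by fact
qed

section \<open>Smooth extension of one coefficient across a resonance\<close>

text \<open>The hypothesis \<open>expansion\<close> is the part of the resonant expansions common to
  the Dulac map and the Dulac time, so one argument serves both. The cutoff is the value of
  \<open>(i, j)\<close> itself, the least one that admits its whole line.\<close>

lemma resonant_coefficient_extends:
  fixes W :: "(real^'n) set" and C :: "int \<Rightarrow> int \<Rightarrow> 'n param \<Rightarrow> real"
  assumes ij: "(i, j) \<in> Lam k" and l0: "l0 \<in> D_res k i j"
    and expansion: "\<And>p q. 0 < p \<Longrightarrow> 0 < q \<Longrightarrow> coprime p q \<Longrightarrow> l0 = real p / real q \<Longrightarrow>
      l0 \<in> D_cut k (real_of_int i + l0 * real_of_int j) \<Longrightarrow>
      \<exists>U' B. open U' \<and> {l0} \<times> W \<subseteq> U' \<and>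
        (\<forall>(i', j') \<in> B_set k l0 (real_of_int i + l0 * real_of_int j).
           smooth_poly_on U' (B i' j') \<and>
           (\<forall>w. \<forall>m\<in>U'. fst m \<noteq> l0 \<longrightarrow>
              B i' j' w m =
                (\<Sum>r \<in> A_set k p q i' j'.
                   C (i' - int r * int p) (j' + int r * int q) m *
                   (1 + (real p - fst m * real q) * w) ^ r)))"
  shows "\<exists>d::nat.
     extends_smoothly W l0 (coeff_dom W k i j) (\<lambda>m. (fst m - l0) ^ d * C i j m) \<and>
     (\<forall>p q::nat. 0 < p \<and> 0 < q \<and> coprime p q \<and> l0 = real p / real q \<longrightarrow>
        real d \<le> real_of_int i / real p + real_of_int j / real q \<and>
        real_of_int i / real p + real_of_int j / real q \<le> real_of_int (i + j))"
proof -
  let ?L = "real_of_int i + l0 * real_of_int j"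
  obtain p q :: nat where pq: "0 < p" "0 < q" "coprime p q" "l0 = real p / real q"
    using D_res_rational[OF l0] .
  obtain i' j' r where top: "(i', j') \<in> Lam k" "i = i' - int r * int p" "j = j' + int r * int q"
    and r: "r \<in> A_set k p q i' j'"
    using top_index[OF ij pq(2)] .
  have same: "real_of_int i' + l0 * real_of_int j' = ?L"
  proof -
    have "l0 * real q = real p" using pq by simp
    then show ?thesis unfolding top(2,3) by (simp add: algebra_simps)
  qed
  have in_B: "(i', j') \<in> B_set k l0 ?L"
    using top(1) same by (simp add: B_set_def)
  \<comment> \<open>When the top index differs from \<open>(i, j)\<close>, the point
    \<open>(i, j)\<close> is itself the witness of its resonance.\<close>
  have "l0 \<in> D_res k i' j'"
  proof (cases "(i', j') = (i, j)")
    case False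
    then show ?thesis
      using ij same D_res_pos(1)[OF ij l0] by (force simp: D_res_def)
  qed (use l0 in simp)
  then have "l0 \<in> D_cut k ?L"
    using in_B D_res_pos(1)[OF ij l0] by (auto simp: D_cut_def)
  from expansion[OF pq this] obtain U' B where U': "open U'" "{l0} \<times> W \<subseteq> U'"
    and smooth: "smooth_poly_on U' (B i' j')"
    and B: "\<forall>w. \<forall>m\<in>U'. fst m \<noteq> l0 \<longrightarrow>
      B i' j' w m = (\<Sum>r \<in> A_set k p q i' j'.
        C (i' - int r * int p) (j' + int r * int q) m * (1 + (real p - fst m * real q) * w) ^ r)"
    by (elim exE conjE, drule_tac bspec[OF _ in_B]) (simp only: prod.case, elim conjE, rule that)
  from smooth obtain d c where c: "\<And>k. k \<le> d \<Longrightarrow> smooth_on U' (c k)"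
    and Bc: "\<And>w m. m \<in> U' \<Longrightarrow> B i' j' w m = (\<Sum>k\<le>d. c k m * w ^ k)"
    unfolding smooth_poly_on_def by blast
  let ?A = "A_set k p q i' j'"
  have "real r \<le> real_of_int i' / real p" if "r \<in> ?A" for r
    using A_set_bound[OF that pq(1)] .
  then have "?A \<subseteq> {..nat \<lfloor>real_of_int i' / real p\<rfloor>}"
    by (auto simp: le_nat_floor)
  then have fin: "finite ?A"
    using finite_subset by blast
  \<comment> \<open>The exponent is the largest index in the sum, not the position \<open>r\<close>
    of the given coefficient, since powers of \<open>w\<close> up to \<open>R\<close> can all
    contribute to it.\<close>
  define R where "R = Max ?A"
  have R: "R \<in> ?A" "?A \<subseteq> {..R}"
    using Max_in[OF fin] Max_ge[OF fin] r by (auto simp: R_def simp del: Max_in)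
  \<comment> \<open>This is the substitution formula with \<open>t = fst m - l0\<close> and
    \<open>\<beta> = - real q\<close>, because p - q \<lambda> = -q (\<lambda> -
    \<open>l0\<close>).\<close>
  define g where "g = (\<lambda>m. \<Sum>k\<in>{..d} \<inter> {..R}.
    c k m * ((fst m - l0) ^ (R - k) * coeff ([:- 1 / - real q, 1 / - real q:] ^ k) r))"
  have "smooth_on U' (\<lambda>m. fst m - l0)"
    using smooth_on_add[OF U'(1) smooth_on_bounded_linear[OF bounded_linear_fst]
        smooth_on_const[of _ "- l0"]] by simp
  then have "smooth_on U' g"
    unfolding g_def
    by (intro smooth_on_sum smooth_on_mult smooth_on_power smooth_on_const c U'(1)) auto
  moreover have "g m = (fst m - l0) ^ R * C i j m" if m: "m \<in> U'" "m \<in> coeff_dom W k i j" for m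
  proof -
    have ne: "fst m \<noteq> l0" using m(2) l0 by (auto simp: coeff_dom_def)
    have "(fst m - l0) ^ R * C (i' - int r * int p) (j' + int r * int q) m = g m"
      unfolding g_def
    proof (rule coeff_of_affine_substitution)
      fix w
      have "real p - fst m * real q = - real q * (fst m - l0)"
        using pq by (simp add: field_simps)
      then show "(\<Sum>k\<le>d. c k m * w ^ k) = (\<Sum>r\<in>?A. C (i' - int r * int p) (j' + int r * int q) m *
          (1 + - real q * (fst m - l0) * w) ^ r)"
        using Bc[OF m(1), of w] B[rule_format, OF m(1) ne, of w] by simp
    qed (use R r pq ne in auto)
    then show ?thesis using top by simp
  qed
  ultimately have "extends_smoothly W l0 (coeff_dom W k i j) (\<lambda>m. (fst m - l0) ^ R * C i j m)"
    unfolding extends_smoothly_def using U' by blast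
  \<comment> \<open>The sum \<open>i / p + j / q\<close> is constant along the line, so it can be
    evaluated at the top index, where \<open>R \<le> i' / p\<close> and \<open>j'\<close> is
    nonnegative.\<close>
  moreover have "real R \<le> real_of_int i / real p + real_of_int j / real q"
  proof -
    have "real R \<le> real_of_int i' / real p" "0 \<le> real_of_int j' / real q"
      using A_set_bound[OF R(1) pq(1)] Lam_nonneg[OF top(1)] by auto
    moreover have "real_of_int i / real p + real_of_int j / real q =
        real_of_int i' / real p + real_of_int j' / real q"
      unfolding top(2,3) using pq(1,2) by (simp add: field_simps)
    ultimately show ?thesis by linarith
  qed
  moreover have "real_of_int i / real p + real_of_int j / real q \<le> real_of_int (i + j)"
  proof -
    have "real_of_int i / real p \<le> real_of_int i" "real_of_int j / real q \<le> real_of_int j"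
      using Lam_nonneg[OF ij] pq mult_left_mono[of 1 "real p" "real_of_int i"]
        mult_left_mono[of 1 "real q" "real_of_int j"] by (auto simp: divide_le_eq)
    then show ?thesis by simp
  qed
  \<comment> \<open>The bounds were shown for one reduced fraction; uniqueness of that fraction
    gives them for all \<open>p\<close> and \<open>q\<close> in the claim.\<close>
  ultimately show ?thesis
    using coprime_fraction_unique[OF pq(3) _ pq(2)] pq(4) by blast
qed

section \<open>Application to the Dulac map and the Dulac time\<close>

theorem lemma3p1:
  fixes W :: "(real^'n) set" and U :: "(real \<times> real) set" and n :: "nat \<times> nat"
    and P1 P2 :: "(real \<times> real) \<times> (real \<times> (real^'n)) \<Rightarrow> real"
    and \<epsilon> :: real and \<sigma>1 \<sigma>2 :: "real \<times> real \<times> (real^'n) \<Rightarrow> real \<times> real"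
    and D T :: "real \<times> real \<times> (real^'n) \<Rightarrow> real"
    and \<Delta> Tc :: "int \<Rightarrow> int \<Rightarrow> real \<times> (real^'n) \<Rightarrow> real"
  assumes "saddle_family W U P1 P2"
    and "transverse_sections W U P1 P2 \<epsilon> \<sigma>1 \<sigma>2"
    and "dulac_map_time n W U P1 P2 \<sigma>1 \<sigma>2 D T"
    and "dulac_map_coeffs W D \<Delta>"
    and "dulac_time_coeffs n W P1 T Tc"
  shows "(\<forall>i j l0. (i, j) \<in> Lam (0, 0) \<and> l0 \<in> D_res (0, 0) i j \<longrightarrow>
            (\<exists>d::nat.
               extends_smoothly W l0 (coeff_dom W (0, 0) i j) (\<lambda>m. (fst m - l0) ^ d * \<Delta> i j m) \<and>
               (\<forall>p q::nat. 0 < p \<and> 0 < q \<and> coprime p q \<and> l0 = real p / real q \<longrightarrow>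
                  real d \<le> real_of_int i / real p + real_of_int j / real q \<and>
                  real_of_int i / real p + real_of_int j / real q \<le> real_of_int (i + j))))
       \<and> (\<forall>i j l0. (i, j) \<in> Lam n \<and> l0 \<in> D_res n i j \<longrightarrow>
            (\<exists>d::nat.
               extends_smoothly W l0 (coeff_dom W n i j) (\<lambda>m. (fst m - l0) ^ d * Tc i j m) \<and>
               (\<forall>p q::nat. 0 < p \<and> 0 < q \<and> coprime p q \<and> l0 = real p / real q \<longrightarrow>
                  real d \<le> real_of_int i / real p + real_of_int j / real q \<and>
                  real_of_int i / real p + real_of_int j / real q \<le> real_of_int (i + j))))"
proof (intro conjI allI impI)
  fix i j l0
  assume asm: "(i, j) \<in> Lam (0, 0) \<and> l0 \<in> D_res (0, 0) i j"
  let ?L = "real_of_int i + l0 * real_of_int j"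
  have pos: "0 < l0" "0 < ?L + l0"
    using D_res_pos[of i j "(0, 0)" l0] asm by auto
  \<comment> \<open>The prefactor \<open>s powr fst m\<close> shifts the cutoff of the Dulac map to
    \<open>L - l0\<close>. Taking \<open>L = ?L + l0\<close> leaves exactly
    \<open>?L\<close>.\<close>
  note coeffs = conjunct2[OF assms(4)[unfolded dulac_map_coeffs_def], rule_format,
      OF pos(2,1), THEN conjunct2, rule_format, unfolded add_diff_cancel_right']
  show "\<exists>d::nat.
      extends_smoothly W l0 (coeff_dom W (0, 0) i j) (\<lambda>m. (fst m - l0) ^ d * \<Delta> i j m) \<and>
      (\<forall>p q::nat. 0 < p \<and> 0 < q \<and> coprime p q \<and> l0 = real p / real q \<longrightarrow>
         real d \<le> real_of_int i / real p + real_of_int j / real q \<and>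
         real_of_int i / real p + real_of_int j / real q \<le> real_of_int (i + j))"
  proof (rule resonant_coefficient_extends)
    fix p q :: nat
    assume "0 < p" "0 < q" "coprime p q" "l0 = real p / real q" "l0 \<in> D_cut (0, 0) ?L"
    from coeffs[of p q, OF conjI[OF this(1) conjI[OF this(2) conjI[OF this(3) conjI[OF this(4,5)]]]]]
    show "\<exists>U' B. open U' \<and> {l0} \<times> W \<subseteq> U' \<and>
        (\<forall>(i', j') \<in> B_set (0, 0) l0 ?L.
           smooth_poly_on U' (B i' j') \<and>
           (\<forall>w. \<forall>m\<in>U'. fst m \<noteq> l0 \<longrightarrow>
              B i' j' w m =
                (\<Sum>r \<in> A_set (0, 0) p q i' j'.
                   \<Delta> (i' - int r * int p) (j' + int r * int q) m *
                   (1 + (real p - fst m * real q) * w) ^ r)))"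
      by blast
  qed (use asm in auto)
next
  fix i j l0
  assume asm: "(i, j) \<in> Lam n \<and> l0 \<in> D_res n i j"
  let ?L = "real_of_int i + l0 * real_of_int j"
  have pos: "0 < l0" "0 < ?L"
    using D_res_pos[of i j n l0] asm by auto
  \<comment> \<open>The sum in the Dulac time has no prefactor, so \<open>L = ?L\<close> is taken
    directly.\<close>
  note coeffs = conjunct2[OF assms(5)[unfolded dulac_time_coeffs_def], rule_format,
      OF pos(2,1), THEN conjunct2, rule_format]
  show "\<exists>d::nat.
      extends_smoothly W l0 (coeff_dom W n i j) (\<lambda>m. (fst m - l0) ^ d * Tc i j m) \<and>
      (\<forall>p q::nat. 0 < p \<and> 0 < q \<and> coprime p q \<and> l0 = real p / real q \<longrightarrow>
         real d \<le> real_of_int i / real p + real_of_int j / real q \<and>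
         real_of_int i / real p + real_of_int j / real q \<le> real_of_int (i + j))"
  proof (rule resonant_coefficient_extends)
    fix p q :: nat
    assume "0 < p" "0 < q" "coprime p q" "l0 = real p / real q" "l0 \<in> D_cut n ?L"
    from coeffs[of p q, OF conjI[OF this(1) conjI[OF this(2) conjI[OF this(3) conjI[OF this(4,5)]]]]]
    show "\<exists>U' B. open U' \<and> {l0} \<times> W \<subseteq> U' \<and>
        (\<forall>(i', j') \<in> B_set n l0 ?L.
           smooth_poly_on U' (B i' j') \<and>
           (\<forall>w. \<forall>m\<in>U'. fst m \<noteq> l0 \<longrightarrow>
              B i' j' w m =
                (\<Sum>r \<in> A_set n p q i' j'.
                   Tc (i' - int r * int p) (j' + int r * int q) m *
                   (1 + (real p - fst m * real q) * w) ^ r)))"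
      by blast
  qed (use asm in auto)
qed

end
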